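(* Let $\Omega\subset\mathbb{R}^n$ be a bounded $C^2$-domain and $0<\lambda\le\Lambda$. Let $F:\mathrm{Sym}(n)\times\Omega\to\mathbb{R}$ be uniformly $(\lambda,\Lambda)$-elliptic with $F(\mathrm{O}_n,x)=0$ for all $x\in\Omega$, and suppose there are $\mathrm{C}_F>0$ and $0<\theta_F<1$ with $\mathrm{osc}_F(x,y)\le \mathrm{C}_F|x-y|^{\theta_F}$ for all $x,y\in\Omega$. Let $p,q\in C^0(\overline\Omega)$ with $0<p(x)\le q(x)$, and put $p_{\min}=\min_{\overline\Omega}p$, $p_{\max}=\max_{\overline\Omega}p$, $q_{\min}=\min_{\overline\Omega}q$. Let $a:\Omega\to[0,\infty)$ be continuous and bounded, let $h\in C^0(\Omega)$ and $0<m\le 1+p_{\min}$. Assume that for some $\mathcal{K}_2>0$ and $\theta\in(0,1)$ one has $|f(x)|\le\mathcal{K}_2|x|^\theta$ in $\Omega$. Let $u$ be a viscosity solution to $$\big[|Du|^{p(x)}+a(x)|Du|^{q(x)}\big]F(D^2u,x)+h(x)|Du|^m=f(x)\quad\text{in }\Omega$$ with $\inf_{x\in\Omega}f(x)>0$. Let $\Omega'\Subset\Omega$ and $\gamma'\in(0,1)$. Given $x_0\in\mathcal{S}_{r,\gamma'}(u,\Omega')$, there exists a constant $\mathrm{c}=\mathrm{c}(m,n,\lambda,\Lambda,p_{\min},q_{\min},\|a\|_{L^\infty(\Omega)},\|h\|_{L^\infty(\Omega)})>0$ such that $$u(x_0)+\mathrm{c}\,r^{\frac{2+\theta+p_{\min}}{1+p_{\min}}}\le\sup_{\partial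 B_r(x_0)}u(x)\qquad\text{for all } r\in(0,2^{-1})\text{ with } \overline{B_r(x_0)}\subset\Omega,$$ provided $$\frac{2+\theta+p_{\min}}{1+p_{\min}}\le\frac{2+p_{\min}-m}{1+p_{\max}-m}$$ holds.
   Context: Singular region: for $0\le r\ll1$ and $\gamma'\in(0,1)$, $\mathcal{S}_{r,\gamma'}(u,\Omega'):=\{x_0\in\Omega'\Subset\Omega:\ |Du(x_0)|\le r^{\gamma'}\}$. $\mathrm{Sym}(n)$ is the space of real symmetric $n\times n$ matrices and $\mathrm{O}_n$ is the zero matrix. With $e_i(\mathrm X)$ the eigenvalues of $\mathrm X$, $\mathscr{P}^{+}_{\lambda,\Lambda}(\mathrm X)=\lambda\sum_{e_i<0}e_i(\mathrm X)+\Lambda\sum_{e_i>0}e_i(\mathrm X)$ and $\mathscr{P}^{-}_{\lambda,\Lambda}(\mathrm X)=\lambda\sum_{e_i>0}e_i(\mathrm X)+\Lambda\sum_{e_i<0}e_i(\mathrm X)$. $F$ is uniformly $(\lambda,\Lambda)$-elliptic if $\mathscr{P}^{-}_{\lambda,\Lambda}(\mathrm M-\mathrm N)\le F(\mathrm M,x)-F(\mathrm N,x)\le\mathscr{P}^{+}_{\lambda,\Lambda}(\mathrm M-\mathrm N)$ for all $\mathrm M,\mathrm N\in\mathrm{Sym}(n)$, $x\in\Omega$. $\mathrm{osc}_F(x,y):=\sup_{\mathrm M\in\mathrm{Sym}(n)\setminus\{0\}}\frac{|F(\mathrm M,x)-F(\mathrm M,y)|}{\|\mathrm M\|}$. Viscosity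 solutions: put $G(x,\eta,\mathrm X)=[|\eta|^{p(x)}+a(x)|\eta|^{q(x)}]F(\mathrm X,x)+h(x)|\eta|^m-f(x)$. A continuous $u$ is a viscosity super-solution of $G(x,Du,D^2u)=0$ if at each $x_0\in\Omega$: when $u$ is constant in a neighbourhood of $x_0$, one has $0\le f$ in some ball $B_\delta(x_0)$ on which $u$ is constant; otherwise, $G(x_0,D\psi(x_0),D^2\psi(x_0))\le0$ for every $\psi\in C^2(\Omega)$ such that $u-\psi$ has a local minimum at $x_0$ and $D\psi(x_0)\ne0$. It is a viscosity sub-solution if the same holds with local maximum, $G\ge0$ and $0\ge f$. A viscosity solution is both.
   Formalization: The constant c is also allowed to depend on inf f; with only the listed parameters the claim is false (n=1, Ω=(1,2), p=q=m=1, a=h=0, f=ε, u=(2/3)√(2ε)|x−3/2|^{3/2}, ε→0). *)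

theory Defs
  imports
    "HOL-Analysis.Analysis"
    "HOL-Probability.Essential_Supremum"
    "HOL-Computational_Algebra.Polynomial"
begin

section \<open>Symmetric matrices, eigenvalues and Pucci operators\<close>

definition Sym :: "(real^'n^'n) set" where
  "Sym = {X. transpose X = X}"

definition charpoly :: "real^'n^'n \<Rightarrow> real poly" where
  "charpoly X = det (\<chi> i j. (if i = j then [:0, 1:] else 0) - [:X $ i $ j:])"

text \<open>The real roots of the characteristic polynomial, with multiplicity. For a symmetric
  matrix these are all \<open>n\<close> eigenvalues.\<close>

definition eigenvals :: "real^'n^'n \<Rightarrow> real multiset" where
  "eigenvals X = proots (charpoly X)"

definition pucci_sup :: "real \<Rightarrow> real \<Rightarrow> real^'n^'n \<Rightarrow> real" where
  "pucci_sup lam Lam X =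
     lam * (\<Sum>\<^sub># {#e \<in># eigenvals X. e < 0#}) + Lam * (\<Sum>\<^sub># {#e \<in># eigenvals X. e > 0#})"

definition pucci_inf :: "real \<Rightarrow> real \<Rightarrow> real^'n^'n \<Rightarrow> real" where
  "pucci_inf lam Lam X =
     lam * (\<Sum>\<^sub># {#e \<in># eigenvals X. e > 0#}) + Lam * (\<Sum>\<^sub># {#e \<in># eigenvals X. e < 0#})"

definition uniformly_elliptic ::
    "real \<Rightarrow> real \<Rightarrow> (real^'n) set \<Rightarrow> (real^'n^'n \<Rightarrow> real^'n \<Rightarrow> real) \<Rightarrow> bool" where
  "uniformly_elliptic lam Lam \<Omega> F \<longleftrightarrow>
     (\<forall>M\<in>Sym. \<forall>N\<in>Sym. \<forall>x\<in>\<Omega>.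
        pucci_inf lam Lam (M - N) \<le> F M x - F N x \<and>
        F M x - F N x \<le> pucci_sup lam Lam (M - N))"

text \<open>The matrix norm is the Frobenius norm; another norm would only change the constant in a
  Hoelder bound. The supremum is taken in the extended reals.\<close>

definition osc :: "(real^'n^'n \<Rightarrow> real^'n \<Rightarrow> real) \<Rightarrow> real^'n \<Rightarrow> real^'n \<Rightarrow> ereal" where
  "osc F x y = (SUP M\<in>Sym - {0}. ereal (\<bar>F M x - F M y\<bar> / norm M))"

section \<open>Function classes and domains\<close>

definition grad :: "(real^'n \<Rightarrow> real) \<Rightarrow> real^'n \<Rightarrow> real^'n" where
  "grad \<psi> x = (\<chi> i. frechet_derivative \<psi> (at x) (axis i 1))"

definition hess :: "(real^'n \<Rightarrow> real) \<Rightarrow> real^'n \<Rightarrow> real^'n^'n" where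
  "hess \<psi> x = jacobian (grad \<psi>) (at x)"

text \<open>Only meaningful for open \<open>\<Omega>\<close>.\<close>

definition C2_on :: "(real^'n) set \<Rightarrow> (real^'n \<Rightarrow> real) \<Rightarrow> bool" where
  "C2_on \<Omega> \<psi> \<longleftrightarrow>
     (\<forall>x\<in>\<Omega>. \<psi> differentiable (at x) \<and> grad \<psi> differentiable (at x)) \<and>
     continuous_on \<Omega> (hess \<psi>)"

text \<open>Near each boundary point, in suitable orthonormal coordinates with last axis \<open>e\<close>, the set
  \<open>\<Omega>\<close> is the strict epigraph of a \<open>C\<^sup>2\<close> function \<open>g\<close> of the other \<open>n - 1\<close> coordinates. To avoid
  the type of dimension \<open>n - 1\<close>, \<open>g\<close> is a function on the whole space that is only evaluated
  at projections onto the hyperplane orthogonal to \<open>e\<close>.\<close>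

definition C2_boundary :: "(real^'n) set \<Rightarrow> bool" where
  "C2_boundary \<Omega> \<longleftrightarrow>
     (\<forall>z\<in>frontier \<Omega>. \<exists>\<delta>>0. \<exists>e g. norm e = 1 \<and> C2_on UNIV g \<and>
        \<Omega> \<inter> ball z \<delta> = {y \<in> ball z \<delta>. g (y - (y \<bullet> e) *\<^sub>R e) < y \<bullet> e})"

definition bounded_C2_domain :: "(real^'n) set \<Rightarrow> bool" where
  "bounded_C2_domain \<Omega> \<longleftrightarrow>
     open \<Omega> \<and> connected \<Omega> \<and> \<Omega> \<noteq> {} \<and> bounded \<Omega> \<and> C2_boundary \<Omega>"

definition compactly_contained :: "(real^'n) set \<Rightarrow> (real^'n) set \<Rightarrow> bool" where
  "compactly_contained \<Omega>' \<Omega> \<longleftrightarrow> compact (closure \<Omega>') \<and> closure \<Omega>' \<subseteq> \<Omega>"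

definition Linf_norm :: "(real^'n) set \<Rightarrow> (real^'n \<Rightarrow> real) \<Rightarrow> ereal" where
  "Linf_norm \<Omega> g = esssup (lebesgue_on \<Omega>) (\<lambda>x. ereal \<bar>g x\<bar>)"

section \<open>Viscosity solutions\<close>

definition constant_near :: "(real^'n) set \<Rightarrow> (real^'n \<Rightarrow> real) \<Rightarrow> real^'n \<Rightarrow> real \<Rightarrow> bool" where
  "constant_near \<Omega> u x \<delta> \<longleftrightarrow> \<delta> > 0 \<and> ball x \<delta> \<subseteq> \<Omega> \<and> (\<forall>y\<in>ball x \<delta>. u y = u x)"

definition eqn_op ::
    "(real^'n \<Rightarrow> real) \<Rightarrow> (real^'n \<Rightarrow> real) \<Rightarrow> (real^'n \<Rightarrow> real) \<Rightarrow> (real^'n^'n \<Rightarrow> real^'n \<Rightarrow> real) \<Rightarrow>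
     (real^'n \<Rightarrow> real) \<Rightarrow> real \<Rightarrow> (real^'n \<Rightarrow> real) \<Rightarrow> real^'n \<Rightarrow> real^'n \<Rightarrow> real^'n^'n \<Rightarrow> real" where
  "eqn_op p q a F h m f x \<eta> X =
     (norm \<eta> powr p x + a x * norm \<eta> powr q x) * F X x + h x * norm \<eta> powr m - f x"

definition viscosity_supersolution ::
    "(real^'n) set \<Rightarrow> (real^'n \<Rightarrow> real^'n \<Rightarrow> real^'n^'n \<Rightarrow> real) \<Rightarrow> (real^'n \<Rightarrow> real) \<Rightarrow>
     (real^'n \<Rightarrow> real) \<Rightarrow> bool" where
  "viscosity_supersolution \<Omega> G f u \<longleftrightarrow> continuous_on \<Omega> u \<and>
     (\<forall>x0\<in>\<Omega>.
        if \<exists>\<delta>. constant_near \<Omega> u x0 \<delta>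
        then \<exists>\<delta>. constant_near \<Omega> u x0 \<delta> \<and> (\<forall>y\<in>ball x0 \<delta>. 0 \<le> f y)
        else \<forall>\<psi>. C2_on \<Omega> \<psi> \<longrightarrow>
               (\<forall>\<^sub>F y in nhds x0. u x0 - \<psi> x0 \<le> u y - \<psi> y) \<longrightarrow> grad \<psi> x0 \<noteq> 0 \<longrightarrow>
               G x0 (grad \<psi> x0) (hess \<psi> x0) \<le> 0)"

definition viscosity_subsolution ::
    "(real^'n) set \<Rightarrow> (real^'n \<Rightarrow> real^'n \<Rightarrow> real^'n^'n \<Rightarrow> real) \<Rightarrow> (real^'n \<Rightarrow> real) \<Rightarrow>
     (real^'n \<Rightarrow> real) \<Rightarrow> bool" where
  "viscosity_subsolution \<Omega> G f u \<longleftrightarrow> continuous_on \<Omega> u \<and>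
     (\<forall>x0\<in>\<Omega>.
        if \<exists>\<delta>. constant_near \<Omega> u x0 \<delta>
        then \<exists>\<delta>. constant_near \<Omega> u x0 \<delta> \<and> (\<forall>y\<in>ball x0 \<delta>. 0 \<ge> f y)
        else \<forall>\<psi>. C2_on \<Omega> \<psi> \<longrightarrow>
               (\<forall>\<^sub>F y in nhds x0. u y - \<psi> y \<le> u x0 - \<psi> x0) \<longrightarrow> grad \<psi> x0 \<noteq> 0 \<longrightarrow>
               G x0 (grad \<psi> x0) (hess \<psi> x0) \<ge> 0)"

definition viscosity_solution ::
    "(real^'n) set \<Rightarrow> (real^'n \<Rightarrow> real^'n \<Rightarrow> real^'n^'n \<Rightarrow> real) \<Rightarrow> (real^'n \<Rightarrow> real) \<Rightarrow>
     (real^'n \<Rightarrow> real) \<Rightarrow> bool" where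
  "viscosity_solution \<Omega> G f u \<longleftrightarrow>
     viscosity_supersolution \<Omega> G f u \<and> viscosity_subsolution \<Omega> G f u"

text \<open>Differentiability of \<open>u\<close> at \<open>x0\<close> is part of the meaning of \<open>\<bar>Du(x0)\<bar> \<le> r\<^sup>\<gamma>\<close>;
  \<open>frechet_derivative\<close> is unspecified elsewhere.\<close>

definition singular_region ::
    "real \<Rightarrow> real \<Rightarrow> (real^'n \<Rightarrow> real) \<Rightarrow> (real^'n) set \<Rightarrow> (real^'n) set" where
  "singular_region r \<gamma> u \<Omega>' =
     {x0 \<in> \<Omega>'. u differentiable (at x0) \<and> norm (grad u x0) \<le> r powr \<gamma>}"

end

theory Submission
  imports Defs
begin

text \<open>
  The lower bound is a comparison with paraboloids. Write \<open>\<beta> = (2 + \<theta> + p\<^sub>m\<^sub>i\<^sub>n) / (1 + p\<^sub>m\<^sub>i\<^sub>n)\<close> and, for a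
  fixed radius \<open>r\<close>, put \<open>K = c * r\<^sup>\<beta>\<^sup>-\<^sup>2\<close>. The paraboloid \<open>K * \<bar>x - y\<bar>\<^sup>2\<close> takes the value \<open>c * r\<^sup>\<beta>\<close> on the
  sphere of radius \<open>r\<close> about \<open>y\<close>. On the scale \<open>r\<close> its gradient is at most \<open>4 * c * r\<^sup>\<beta>\<^sup>-\<^sup>1 \<le> 1\<close> and its
  Hessian is \<open>2 * K\<close> times the identity, so the degenerate diffusion term is at most a multiple of
  \<open>c * r powr ((\<beta> - 1) * p x + \<beta> - 2)\<close>. The growth rate \<open>\<beta>\<close> is chosen so that this exponent of \<open>r\<close> is
  at least \<open>\<theta> > 0\<close>, and the gradient term is at most a multiple of \<open>c\<^sup>m\<close>. Hence both terms are
  arbitrarily small, uniformly in \<open>r < 1/2\<close>, once \<open>c\<close> is small. As \<open>f\<close> is bounded below by \<open>f\<^sub>i\<^sub>n\<^sub>f > 0\<close>, the paraboloids are strict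
  supersolutions away from their vertex (\<open>paraboloid_strict_supersolution\<close>), and a subsolution
  cannot be touched by them from above there.

  The vertex is the delicate point: test functions with vanishing gradient carry no
  information. If the asserted inequality failed, then for every \<open>y\<close> near \<open>x0\<close> the function
  \<open>u - K * \<bar>x - y\<bar>\<^sup>2\<close> would have its maximum over the closed ball in the interior, hence at the vertex
  \<open>y\<close> itself. So \<open>u x - u y \<le> K * \<bar>x - y\<bar>\<^sup>2\<close> for \<open>x\<close>, \<open>y\<close> near \<open>x0\<close>, which forces \<open>u\<close> to be
  constant there, and this contradicts \<open>f > 0\<close> (\<open>subsolution_sphere_growth\<close>).
\<close>

section \<open>Pucci operator of a multiple of the identity\<close>

lemma eigenvals_mat: "eigenvals (mat k :: real^'n^'n) = replicate_mset CARD('n) k"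
proof -
  have "charpoly (mat k :: real^'n^'n) = [:- k, 1:] ^ CARD('n)"
    unfolding charpoly_def by (subst det_diagonal) (auto simp: mat_def)
  then show ?thesis
    by (simp add: eigenvals_def proots_power)
qed

lemma pucci_sup_mat:
  assumes "0 < k"
  shows "pucci_sup lam Lam (mat k :: real^'n^'n) = Lam * (real CARD('n) * k)"
proof -
  have "{#e \<in># replicate_mset j k. e < 0#} = {#}"
    and "{#e \<in># replicate_mset j k. e > 0#} = replicate_mset j k" for j
    using assms by (induction j) auto
  then show ?thesis
    unfolding pucci_sup_def eigenvals_mat by (simp only: sum_mset_replicate_mset) simp
qed

lemma uniformly_elliptic_mat_le:
  fixes F :: "real^'n^'n \<Rightarrow> real^'n \<Rightarrow> real"
  assumes "uniformly_elliptic lam Lam \<Omega> F" "x \<in> \<Omega>" "F 0 x = 0" "0 < k"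
  shows "F (mat k) x \<le> Lam * (real CARD('n) * k)"
proof -
  have "(mat k :: real^'n^'n) \<in> Sym" "(0 :: real^'n^'n) \<in> Sym"
    by (auto simp: Sym_def transpose_def mat_def vec_eq_iff)
  then have "F (mat k) x - F 0 x \<le> pucci_sup lam Lam (mat k - (0 :: real^'n^'n))"
    using assms(1,2) unfolding uniformly_elliptic_def by blast
  then show ?thesis
    using assms(3,4) by (simp add: pucci_sup_mat)
qed

section \<open>Paraboloids as test functions\<close>

lemma grad_paraboloid: "grad (\<lambda>x. K * (norm (x - y))\<^sup>2) = (\<lambda>x. (2 * K) *\<^sub>R (x - y))" (is ?grad)
  and differentiable_paraboloid: "(\<lambda>x. K * (norm (x - y))\<^sup>2) differentiable (at x)" (is ?diff)
proof -
  have D: "((\<lambda>x. K * (norm (x - y))\<^sup>2) has_derivative (\<lambda>v. 2 * K * ((x - y) \<bullet> v))) (at x)" for x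
    unfolding power2_norm_eq_inner
    by (auto intro!: derivative_eq_intros simp: inner_commute algebra_simps)
  then have "frechet_derivative (\<lambda>x. K * (norm (x - y))\<^sup>2) (at x) = (\<lambda>v. 2 * K * ((x - y) \<bullet> v))" for x
    by (rule frechet_derivative_at[symmetric])
  then show ?grad
    by (simp add: fun_eq_iff grad_def vec_eq_iff inner_axis)
  show ?diff
    using D by (rule differentiableI)
qed

lemma hess_paraboloid:
  fixes y :: "real^'n"
  shows "hess (\<lambda>x. K * (norm (x - y))\<^sup>2) = (\<lambda>x. mat (2 * K))"
proof -
  have "((\<lambda>x. (2 * K) *\<^sub>R (x - y)) has_derivative (*\<^sub>R) (2 * K)) (at x)" for x :: "real^'n"
    by (auto intro!: derivative_eq_intros)
  then have "frechet_derivative (\<lambda>x. (2 * K) *\<^sub>R (x - y)) (at x) = (*\<^sub>R) (2 * K)" for x :: "real^'n"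
    by (rule frechet_derivative_at[symmetric])
  then show ?thesis
    by (intro ext) (simp only: hess_def grad_paraboloid jacobian_def matrix_scaleR)
qed

lemma C2_on_paraboloid: "C2_on \<Omega> (\<lambda>x. K * (norm (x - y))\<^sup>2)"
  unfolding C2_on_def hess_paraboloid grad_paraboloid
  by (intro conjI ballI differentiable_paraboloid derivative_intros continuous_intros)

section \<open>Growth of subsolutions on spheres\<close>

lemma quadratic_modulus_imp_constant:
  fixes u :: "'a::real_normed_vector \<Rightarrow> real"
  assumes "convex S"
    and le: "\<And>x y. x \<in> S \<Longrightarrow> y \<in> S \<Longrightarrow> u x - u y \<le> K * (norm (x - y))\<^sup>2"
    and "x \<in> S" "y \<in> S"
  shows "u x = u y"
proof -
  have "(u has_derivative (\<lambda>h. 0)) (at z within S)" if z: "z \<in> S" for z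
  proof (rule has_derivativeI)
    have "\<bar>u w - u z\<bar> \<le> K * norm (w - z) * norm (w - z)" if "w \<in> S" for w
      using le[OF that z] le[OF z that] by (auto simp: power2_eq_square norm_minus_commute)
    then have bound: "norm ((u w - u z - 0) /\<^sub>R norm (w - z)) \<le> K * norm (w - z)" if "w \<in> S" "w \<noteq> z" for w
      using that by (simp add: divide_simps)
    have "\<forall>\<^sub>F w in at z within S. norm ((u w - u z - 0) /\<^sub>R norm (w - z)) \<le> K * norm (w - z)"
      unfolding eventually_at_filter using bound by (intro always_eventually) blast
    moreover have "((\<lambda>w. K * norm (w - z)) \<longlongrightarrow> 0) (at z within S)"
      by (auto intro!: tendsto_eq_intros)
    ultimately show "((\<lambda>w. (u w - u z - 0) /\<^sub>R norm (w - z)) \<longlongrightarrow> 0) (at z within S)"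
      by (rule Lim_null_comparison)
  qed simp
  then show ?thesis
    using has_derivative_zero_constant[OF \<open>convex S\<close>, of u] \<open>x \<in> S\<close> \<open>y \<in> S\<close> by metis
qed

lemma subsolution_not_constant_near:
  assumes "viscosity_subsolution \<Omega> G f u" "x \<in> \<Omega>" "0 < f x"
  shows "\<not> constant_near \<Omega> u x \<delta>"
proof
  assume c: "constant_near \<Omega> u x \<delta>"
  then obtain \<delta>' where "constant_near \<Omega> u x \<delta>'" "\<forall>y\<in>ball x \<delta>'. 0 \<ge> f y"
    using assms(1,2) unfolding viscosity_subsolution_def by meson
  then show False
    using assms(3) centre_in_ball[of x \<delta>'] unfolding constant_near_def by fastforce
qed

text \<open>The vertex is moved over a neighbourhood of \<open>x0\<close> because one paraboloid alone cannot
  exclude a maximum at its own vertex, where its gradient vanishes.\<close>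

lemma subsolution_sphere_growth:
  fixes u :: "real^'n \<Rightarrow> real"
  assumes sub: "viscosity_subsolution \<Omega> G f u" and f_pos: "\<And>x. x \<in> \<Omega> \<Longrightarrow> 0 < f x"
    and r: "0 < r" "cball x0 r \<subseteq> \<Omega>" and K: "0 < K"
    and strict: "\<And>x y. x \<in> ball x0 r \<Longrightarrow> y \<in> ball x0 r \<Longrightarrow> x \<noteq> y \<Longrightarrow>
                   G x ((2 * K) *\<^sub>R (x - y)) (mat (2 * K)) < 0"
  shows "u x0 + K * r\<^sup>2 \<le> Sup (u ` sphere x0 r)"
proof (rule ccontr)
  let ?S = "Sup (u ` sphere x0 r)"
  assume "\<not> u x0 + K * r\<^sup>2 \<le> ?S"
  then have less: "?S < u x0 + K * (r - dist x0 x0)\<^sup>2"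
    by simp
  have cont: "continuous_on \<Omega> u"
    using sub by (simp add: viscosity_subsolution_def)
  have cont_cball: "continuous_on (cball x0 r) u"
    using cont r(2) by (rule continuous_on_subset)
  then have "compact (u ` sphere x0 r)"
    by (intro compact_continuous_image compact_sphere) (rule continuous_on_subset, auto)
  then have sphere_le: "u x \<le> ?S" if "x \<in> sphere x0 r" for x
    using that by (intro cSup_upper) (auto dest: compact_imp_bounded bounded_imp_bdd_above)
  have "isCont u x0"
    using cont_cball r(1) by (auto intro: continuous_on_interior)
  then have "((\<lambda>y. u y + K * (r - dist x0 y)\<^sup>2) \<longlongrightarrow> u x0 + K * (r - dist x0 x0)\<^sup>2) (nhds x0)"
    by (intro tendsto_intros) (simp_all add: isCont_def tendsto_at_iff_tendsto_nhds filterlim_ident)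
  then have "\<forall>\<^sub>F y in nhds x0. ?S < u y + K * (r - dist x0 y)\<^sup>2"
    using less by (rule order_tendstoD)
  then obtain \<delta>0 where \<delta>0: "0 < \<delta>0"
    and near0: "\<And>y. dist y x0 < \<delta>0 \<Longrightarrow> ?S < u y + K * (r - dist x0 y)\<^sup>2"
    by (auto simp: eventually_nhds_metric)
  define \<delta> where "\<delta> = min \<delta>0 r"
  have \<delta>: "0 < \<delta>" "\<delta> \<le> r" and near: "\<And>y. y \<in> ball x0 \<delta> \<Longrightarrow> ?S < u y + K * (r - dist x0 y)\<^sup>2"
    using \<delta>0 r(1) near0 by (auto simp: \<delta>_def dist_commute)
  have max_at_vertex: "u x - u y \<le> K * (norm (x - y))\<^sup>2"
    if y: "y \<in> ball x0 \<delta>" and x: "x \<in> cball x0 r" for x y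
  proof -
    let ?\<psi> = "\<lambda>z. K * (norm (z - y))\<^sup>2"
    have "continuous_on (cball x0 r) (\<lambda>z. u z - ?\<psi> z)"
      by (intro continuous_intros cont_cball)
    then obtain z where z: "z \<in> cball x0 r"
      and z_max: "\<And>w. w \<in> cball x0 r \<Longrightarrow> u w - ?\<psi> w \<le> u z - ?\<psi> z"
      using continuous_attains_sup[of "cball x0 r" "\<lambda>z. u z - ?\<psi> z"] r(1) by force
    have y_in: "y \<in> ball x0 r"
      using y \<delta> by auto
    have "z \<notin> sphere x0 r"
    proof
      assume zs: "z \<in> sphere x0 r"
      have "r - dist x0 y \<le> norm (z - y)"
        using zs dist_triangle[of x0 z y] by (simp add: dist_norm norm_minus_commute)
      then have "K * (r - dist x0 y)\<^sup>2 \<le> ?\<psi> z"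
        using K y_in by (intro mult_left_mono power_mono) auto
      moreover have "u y \<le> u z - ?\<psi> z"
        using z_max[of y] y_in by simp
      ultimately show False
        using near[OF y] sphere_le[OF zs] by linarith
    qed
    then have z_in: "z \<in> ball x0 r"
      using z by auto
    then have z_\<Omega>: "z \<in> \<Omega>"
      using r(2) by auto
    have "z = y"
    proof (rule ccontr)
      assume "z \<noteq> y"
      have "\<forall>\<^sub>F w in nhds z. w \<in> ball x0 r"
        using z_in by (intro eventually_nhds_in_open) auto
      then have "\<forall>\<^sub>F w in nhds z. u w - ?\<psi> w \<le> u z - ?\<psi> z"
        by (rule eventually_mono) (use z_max in auto)
      moreover have "grad ?\<psi> z \<noteq> 0"
        using K \<open>z \<noteq> y\<close> by (simp add: grad_paraboloid)
      moreover have "\<not> (\<exists>\<delta>. constant_near \<Omega> u z \<delta>)"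
        using subsolution_not_constant_near[OF sub z_\<Omega> f_pos[OF z_\<Omega>]] by blast
      ultimately have "G z (grad ?\<psi> z) (hess ?\<psi> z) \<ge> 0"
        using sub z_\<Omega> C2_on_paraboloid[of \<Omega> K y] unfolding viscosity_subsolution_def by meson
      then show False
        using strict[OF z_in y_in \<open>z \<noteq> y\<close>] by (simp add: grad_paraboloid hess_paraboloid)
    qed
    then show ?thesis
      using z_max[OF x] by simp
  qed
  have const: "u y = u x0" if "y \<in> ball x0 \<delta>" for y
  proof (rule quadratic_modulus_imp_constant[where S = "ball x0 \<delta>" and K = K])
    fix x y assume "x \<in> ball x0 \<delta>" "y \<in> ball x0 \<delta>"
    then show "u x - u y \<le> K * (norm (x - y))\<^sup>2"
      using max_at_vertex[of y x] \<delta> by auto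
  qed (use that \<delta>(1) in auto)
  have "ball x0 \<delta> \<subseteq> \<Omega>"
    using \<delta> r(2) by auto
  then have "constant_near \<Omega> u x0 \<delta>"
    unfolding constant_near_def using const \<delta>(1) by blast
  moreover have "x0 \<in> \<Omega>"
    using r by auto
  ultimately show False
    using subsolution_not_constant_near[OF sub] f_pos by blast
qed

section \<open>Pointwise bounds from essential bounds\<close>

text \<open>For a continuous function the set where an essential bound fails is open and null, hence
  empty.\<close>

lemma abs_le_Linf_norm:
  fixes g :: "real^'n \<Rightarrow> real"
  assumes "open \<Omega>" "continuous_on \<Omega> g" "Linf_norm \<Omega> g = ereal A" "x \<in> \<Omega>"
  shows "\<bar>g x\<bar> \<le> A"
proof (rule ccontr)
  assume "\<not> \<bar>g x\<bar> \<le> A"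
  define U where "U = \<Omega> \<inter> (\<lambda>y. \<bar>g y\<bar>) -` {A<..}"
  have "open U"
    unfolding U_def using assms(1,2) by (intro continuous_open_preimage continuous_on_rabs open_greaterThan)
  have "AE y in lebesgue_on \<Omega>. ereal \<bar>g y\<bar> \<le> ereal A"
    using esssup_AE[of "\<lambda>y. ereal \<bar>g y\<bar>" "lebesgue_on \<Omega>"] assms(3) by (simp add: Linf_norm_def)
  then have "AE y in lebesgue. y \<in> \<Omega> \<longrightarrow> \<bar>g y\<bar> \<le> A"
    using assms(1) by (simp add: AE_restrict_space_iff borel_open)
  then have "AE y in lebesgue. y \<in> U \<longrightarrow> y \<in> {}"
    by (rule AE_mp) (auto simp: U_def)
  then have "x \<notin> U"
    using mem_closed_if_AE_lebesgue_open[OF \<open>open U\<close>, of "{}" x] by auto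
  then show False
    using \<open>\<not> \<bar>g x\<bar> \<le> A\<close> \<open>x \<in> \<Omega>\<close> by (simp add: U_def)
qed

section \<open>Paraboloids of small opening are strict supersolutions\<close>

text \<open>The two summands bound the diffusion term and the gradient term of the operator on a paraboloid
  with opening parameter \<open>c\<close>; the bound \<open>c \<le> 1 / 4\<close> keeps its gradient at most \<open>1\<close> on the relevant ball.\<close>

lemma small_opening_exists:
  fixes B H m \<epsilon> :: real
  assumes "0 < m" "0 < \<epsilon>"
  obtains c where "0 < c" "c \<le> 1 / 4" "B * c + H * (4 * c) powr m < \<epsilon>"
proof -
  have "((\<lambda>c. B * c + H * (4 * c) powr m) \<longlongrightarrow> B * 0 + H * 0) (at_right 0)"
    using \<open>0 < m\<close>
    by (intro tendsto_intros tendsto_zero_powrI[where b = m])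
       (auto intro!: tendsto_eq_intros simp: eventually_at_filter)
  then have "\<forall>\<^sub>F c in at_right 0. B * c + H * (4 * c) powr m < \<epsilon>"
    using \<open>0 < \<epsilon>\<close> by (auto dest: order_tendstoD)
  moreover have "\<forall>\<^sub>F c in at_right (0::real). c < 1 / 4"
    by (intro order_tendstoD[OF tendsto_ident_at]) simp
  moreover have "\<forall>\<^sub>F c in at_right (0::real). 0 < c"
    by (rule eventually_at_right_less)
  ultimately have "\<forall>\<^sub>F c in at_right 0. 0 < c \<and> c < 1 / 4 \<and> B * c + H * (4 * c) powr m < \<epsilon>"
    by eventually_elim simp
  then have "\<exists>c>0. c < 1 / 4 \<and> B * c + H * (4 * c) powr m < \<epsilon>"
    using eventually_happens[of _ "at_right (0::real)"] by fastforce
  then show thesis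
    using that by force
qed

text \<open>The assumption on \<open>\<beta>\<close> balances the degeneracy \<open>\<bar>\<eta>\<bar> powr p\<close> of a gradient of size
  \<open>r powr (\<beta> - 1)\<close> against a Hessian of size \<open>r powr (\<beta> - 2)\<close>, which may blow up as \<open>r \<rightarrow> 0\<close>.\<close>

lemma paraboloid_strict_supersolution:
  fixes F :: "real^'n^'n \<Rightarrow> real^'n \<Rightarrow> real" and x y :: "real^'n"
  assumes ell: "uniformly_elliptic lam Lam \<Omega> F" "F 0 x = 0" "x \<in> \<Omega>" and Lam: "0 < Lam"
    and pq: "0 < p x" "p x \<le> q x"
    and a: "0 \<le> a x" "a x \<le> A" and h: "\<bar>h x\<bar> \<le> H"
    and "0 < m"
    and c: "0 < c" "c \<le> 1 / 4"
      "2 * Lam * real CARD('n) * (1 + A) * c + H * (4 * c) powr m < f x"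
    and \<beta>: "1 \<le> \<beta>" "0 \<le> (\<beta> - 1) * p x + (\<beta> - 2)"
    and r: "0 < r" "r < 1 / 2" and xy: "x \<noteq> y" "norm (x - y) < 2 * r"
    and K: "K = c * r powr (\<beta> - 2)"
  shows "eqn_op p q a F h m f x ((2 * K) *\<^sub>R (x - y)) (mat (2 * K)) < 0"
proof -
  define N where "N = 2 * K * norm (x - y)"
  have K_pos: "0 < K"
    using c(1) r(1) by (simp add: K)
  have N_norm: "norm ((2 * K) *\<^sub>R (x - y)) = N"
    using K_pos by (simp add: N_def)
  have N_pos: "0 < N"
    using K_pos xy(1) by (simp add: N_def)
  have "N \<le> 2 * K * (2 * r)"
    unfolding N_def using K_pos xy(2) by (intro mult_left_mono) auto
  also have "\<dots> = 4 * c * (r powr (\<beta> - 2) * r powr 1)"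
    using r(1) by (simp add: K)
  also have "\<dots> = 4 * c * r powr (\<beta> - 1)"
    by (simp only: powr_add[symmetric]) simp
  finally have N_le: "N \<le> 4 * c * r powr (\<beta> - 1)" .
  have "r powr (\<beta> - 1) \<le> 1"
    using r \<beta> by (intro powr_le1) auto
  then have N_le_4c: "N \<le> 4 * c"
    using N_le c(1) mult_left_mono[of "r powr (\<beta> - 1)" 1 "4 * c"] by linarith
  have diffusion: "N powr p x * K \<le> c"
  proof -
    have "N powr p x \<le> (4 * c * r powr (\<beta> - 1)) powr p x"
      using N_le N_pos pq by (intro powr_mono2) auto
    also have "\<dots> = (4 * c) powr p x * r powr ((\<beta> - 1) * p x)"
      using c(1) by (simp add: powr_mult powr_powr)
    also have "\<dots> \<le> 1 * r powr ((\<beta> - 1) * p x)"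
      using c pq by (intro mult_right_mono powr_le1) auto
    finally have "N powr p x * K \<le> r powr ((\<beta> - 1) * p x) * K"
      using K_pos by (intro mult_right_mono) auto
    also have "\<dots> = c * r powr ((\<beta> - 1) * p x + (\<beta> - 2))"
      by (simp add: K powr_add)
    also have "\<dots> \<le> c * 1"
      using r \<beta> c(1) by (intro mult_left_mono powr_le1) auto
    finally show ?thesis by simp
  qed
  have coeff: "N powr p x + a x * N powr q x \<le> (1 + A) * N powr p x"
  proof -
    have "N powr q x \<le> N powr p x"
      using N_pos N_le_4c c(2) pq(2) by (intro powr_mono') auto
    then have "a x * N powr q x \<le> A * N powr p x"
      using a by (intro mult_mono) auto
    then show ?thesis
      by (simp add: algebra_simps)
  qed
  have "(N powr p x + a x * N powr q x) * F (mat (2 * K)) x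
      \<le> (N powr p x + a x * N powr q x) * (Lam * (real CARD('n) * (2 * K)))"
    using uniformly_elliptic_mat_le[OF ell(1,3,2), of "2 * K"] K_pos a
    by (intro mult_left_mono) auto
  also have "\<dots> \<le> (1 + A) * N powr p x * (Lam * (real CARD('n) * (2 * K)))"
    using coeff K_pos Lam by (intro mult_right_mono) auto
  also have "\<dots> = 2 * Lam * real CARD('n) * (1 + A) * (N powr p x * K)"
    by simp
  also have "\<dots> \<le> 2 * Lam * real CARD('n) * (1 + A) * c"
    using diffusion Lam a by (intro mult_left_mono) auto
  finally have "(N powr p x + a x * N powr q x) * F (mat (2 * K)) x
      \<le> 2 * Lam * real CARD('n) * (1 + A) * c" .
  moreover have "h x * N powr m \<le> H * (4 * c) powr m"
    using h N_pos N_le_4c \<open>0 < m\<close> by (intro mult_mono powr_mono2) auto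
  ultimately show ?thesis
    using c(3) unfolding eqn_op_def N_norm by linarith
qed

section \<open>Nondegeneracy\<close>

theorem theorem1p3:
  fixes m lam Lam p\<^sub>m\<^sub>i\<^sub>n q\<^sub>m\<^sub>i\<^sub>n A H f\<^sub>i\<^sub>n\<^sub>f :: real
  assumes "0 < lam" and "lam \<le> Lam"
    and "0 < m" and "m \<le> 1 + p\<^sub>m\<^sub>i\<^sub>n"
    and "0 < f\<^sub>i\<^sub>n\<^sub>f"
  shows "\<exists>c>0. \<forall>(\<Omega> :: (real^'n) set) F C\<^sub>F \<theta>\<^sub>F p q p\<^sub>m\<^sub>a\<^sub>x a h f K\<^sub>2 \<theta> u \<Omega>' \<gamma>' \<rho> x0.
     bounded_C2_domain \<Omega> \<and>
     uniformly_elliptic lam Lam \<Omega> F \<and> (\<forall>x\<in>\<Omega>. F 0 x = 0) \<and>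
     0 < C\<^sub>F \<and> 0 < \<theta>\<^sub>F \<and> \<theta>\<^sub>F < 1 \<and>
     (\<forall>x\<in>\<Omega>. \<forall>y\<in>\<Omega>. osc F x y \<le> ereal (C\<^sub>F * norm (x - y) powr \<theta>\<^sub>F)) \<and>
     continuous_on (closure \<Omega>) p \<and> continuous_on (closure \<Omega>) q \<and>
     (\<forall>x\<in>closure \<Omega>. 0 < p x \<and> p x \<le> q x) \<and>
     p\<^sub>m\<^sub>i\<^sub>n = Inf (p ` closure \<Omega>) \<and> p\<^sub>m\<^sub>a\<^sub>x = Sup (p ` closure \<Omega>) \<and> q\<^sub>m\<^sub>i\<^sub>n = Inf (q ` closure \<Omega>) \<and>
     (\<forall>x\<in>\<Omega>. 0 \<le> a x) \<and> continuous_on \<Omega> a \<and> bounded (a ` \<Omega>) \<and> Linf_norm \<Omega> a = ereal A \<and>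
     continuous_on \<Omega> h \<and> Linf_norm \<Omega> h = ereal H \<and>
     0 < K\<^sub>2 \<and> 0 < \<theta> \<and> \<theta> < 1 \<and> (\<forall>x\<in>\<Omega>. \<bar>f x\<bar> \<le> K\<^sub>2 * norm x powr \<theta>) \<and>
     Inf (f ` \<Omega>) = f\<^sub>i\<^sub>n\<^sub>f \<and>
     viscosity_solution \<Omega> (eqn_op p q a F h m f) f u \<and>
     compactly_contained \<Omega>' \<Omega> \<and> 0 < \<gamma>' \<and> \<gamma>' < 1 \<and>
     0 \<le> \<rho> \<and> \<rho> < 1 \<and> x0 \<in> singular_region \<rho> \<gamma>' u \<Omega>' \<and>
     (2 + \<theta> + p\<^sub>m\<^sub>i\<^sub>n) / (1 + p\<^sub>m\<^sub>i\<^sub>n) \<le> (2 + p\<^sub>m\<^sub>i\<^sub>n - m) / (1 + p\<^sub>m\<^sub>a\<^sub>x - m)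
     \<longrightarrow>
     (\<forall>r. 0 < r \<and> r < 1 / 2 \<and> cball x0 r \<subseteq> \<Omega> \<longrightarrow>
        u x0 + c * r powr ((2 + \<theta> + p\<^sub>m\<^sub>i\<^sub>n) / (1 + p\<^sub>m\<^sub>i\<^sub>n)) \<le> Sup (u ` sphere x0 r))"
proof -
  define n where "n = real CARD('n)"
  obtain c where c: "0 < c" "c \<le> 1 / 4"
    and c_small: "2 * Lam * n * (1 + A) * c + H * (4 * c) powr m < f\<^sub>i\<^sub>n\<^sub>f"
    using small_opening_exists[OF \<open>0 < m\<close> \<open>0 < f\<^sub>i\<^sub>n\<^sub>f\<close>, of "2 * Lam * n * (1 + A)" H] by metis
  show ?thesis
  proof (intro exI[of _ c] conjI allI impI \<open>0 < c\<close>; (elim conjE)?)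
    fix \<Omega> :: "(real^'n) set" and F p q a h f u x0 and p\<^sub>m\<^sub>a\<^sub>x K\<^sub>2 \<theta> r :: real
    assume dom: "bounded_C2_domain \<Omega>" and ell: "uniformly_elliptic lam Lam \<Omega> F"
      and F0: "\<forall>x\<in>\<Omega>. F 0 x = 0"
      and p_cont: "continuous_on (closure \<Omega>) p"
      and pq: "\<forall>x\<in>closure \<Omega>. 0 < p x \<and> p x \<le> q x"
      and p_min: "p\<^sub>m\<^sub>i\<^sub>n = Inf (p ` closure \<Omega>)"
      and a: "\<forall>x\<in>\<Omega>. 0 \<le> a x" "continuous_on \<Omega> a" "Linf_norm \<Omega> a = ereal A"
      and h: "continuous_on \<Omega> h" "Linf_norm \<Omega> h = ereal H"
      and \<theta>: "0 < \<theta>"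
      and K\<^sub>2: "0 < K\<^sub>2" and f_le: "\<forall>x\<in>\<Omega>. \<bar>f x\<bar> \<le> K\<^sub>2 * norm x powr \<theta>"
      and f_inf: "Inf (f ` \<Omega>) = f\<^sub>i\<^sub>n\<^sub>f"
      and sol: "viscosity_solution \<Omega> (eqn_op p q a F h m f) f u"
      and r: "0 < r" "r < 1 / 2" "cball x0 r \<subseteq> \<Omega>"
    define \<beta> where "\<beta> = (2 + \<theta> + p\<^sub>m\<^sub>i\<^sub>n) / (1 + p\<^sub>m\<^sub>i\<^sub>n)"
    have "open \<Omega>" "bounded \<Omega>" "\<Omega> \<noteq> {}"
      using dom by (auto simp: bounded_C2_domain_def)
    obtain B where B: "\<And>x. x \<in> \<Omega> \<Longrightarrow> norm x \<le> B"
      using \<open>bounded \<Omega>\<close> by (auto simp: bounded_iff)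
    have "- (K\<^sub>2 * B powr \<theta>) \<le> f x" if "x \<in> \<Omega>" for x
    proof -
      have "K\<^sub>2 * norm x powr \<theta> \<le> K\<^sub>2 * B powr \<theta>"
        using B[OF that] \<theta> K\<^sub>2 by (intro mult_left_mono powr_mono2) auto
      then show ?thesis
        using f_le that by force
    qed
    then have "bdd_below (f ` \<Omega>)"
      by (auto intro!: bdd_belowI)
    then have f_ge: "f\<^sub>i\<^sub>n\<^sub>f \<le> f x" if "x \<in> \<Omega>" for x
      using that f_inf by (auto intro: cInf_lower)
    have "compact (p ` closure \<Omega>)"
      using p_cont \<open>bounded \<Omega>\<close> by (intro compact_continuous_image) auto
    then have p_ge: "p\<^sub>m\<^sub>i\<^sub>n \<le> p x" if "x \<in> closure \<Omega>" for x
      using that unfolding p_min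
      by (intro cInf_lower) (auto dest: compact_imp_bounded bounded_imp_bdd_below)
    have p_min_nonneg: "0 \<le> p\<^sub>m\<^sub>i\<^sub>n"
      unfolding p_min using pq \<open>\<Omega> \<noteq> {}\<close> by (intro cInf_greatest) (auto intro: less_imp_le)
    have \<beta>_ge: "1 \<le> \<beta>"
      using p_min_nonneg \<theta> by (simp add: \<beta>_def divide_simps)
    (* Where p attains its minimum, the powers of r combine to exactly r powr \<theta>. *)
    have \<beta>_balance: "(\<beta> - 1) * p\<^sub>m\<^sub>i\<^sub>n + (\<beta> - 2) = \<theta>"
      using p_min_nonneg by (simp add: \<beta>_def divide_simps) (simp add: algebra_simps)
    define K where "K = c * r powr (\<beta> - 2)"
    have K_sphere: "K * r\<^sup>2 = c * r powr \<beta>"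
      using r(1) by (simp add: K_def powr_diff)
    have "u x0 + K * r\<^sup>2 \<le> Sup (u ` sphere x0 r)"
    proof (rule subsolution_sphere_growth)
      show "viscosity_subsolution \<Omega> (eqn_op p q a F h m f) f u"
        using sol by (simp add: viscosity_solution_def)
      show "0 < f x" if "x \<in> \<Omega>" for x
        using f_ge[OF that] \<open>0 < f\<^sub>i\<^sub>n\<^sub>f\<close> by linarith
      show "0 < K"
        using c r by (simp add: K_def)
      fix x y assume x: "x \<in> ball x0 r" and y: "y \<in> ball x0 r" and "x \<noteq> y"
      have x_\<Omega>: "x \<in> \<Omega>" and x_cl: "x \<in> closure \<Omega>"
        using x r(3) closure_subset[of \<Omega>] by (auto simp: subset_iff)
      have "(\<beta> - 1) * p\<^sub>m\<^sub>i\<^sub>n \<le> (\<beta> - 1) * p x"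
        using p_ge[OF x_cl] \<beta>_ge by (intro mult_left_mono) auto
      then have balance: "0 \<le> (\<beta> - 1) * p x + (\<beta> - 2)"
        using \<beta>_balance \<theta> by linarith
      have dist: "norm (x - y) < 2 * r"
        using x y dist_triangle2[of x y x0] by (simp add: dist_norm norm_minus_commute)
      have "\<bar>a x\<bar> \<le> A" "\<bar>h x\<bar> \<le> H"
        using abs_le_Linf_norm[OF \<open>open \<Omega>\<close> _ _ x_\<Omega>] a h by auto
      then show "eqn_op p q a F h m f x ((2 * K) *\<^sub>R (x - y)) (mat (2 * K)) < 0"
        using ell F0 x_\<Omega> x_cl a(1) pq c c_small f_ge[OF x_\<Omega>] \<beta>_ge balance r dist \<open>x \<noteq> y\<close>
          \<open>0 < m\<close> \<open>0 < lam\<close> \<open>lam \<le> Lam\<close>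
        by (intro paraboloid_strict_supersolution[where lam = lam and Lam = Lam and \<Omega> = \<Omega>
              and A = A and H = H and c = c and \<beta> = \<beta> and r = r])
           (auto simp: K_def n_def)
    qed (use r in auto)
    then show "u x0 + c * r powr ((2 + \<theta> + p\<^sub>m\<^sub>i\<^sub>n) / (1 + p\<^sub>m\<^sub>i\<^sub>n)) \<le> Sup (u ` sphere x0 r)"
      by (simp add: K_sphere \<beta>_def)
  qed
qed

end
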